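(* Let $X$ be a normed linear space. Then $X$ is finite dimensional if and only if every open, convex, unbounded subset of $X$ is a union of parallel half-lines.
   Context: Normed linear spaces are over $\mathbb{R}$ or $\mathbb{C}$. A (open straight) half-line in a normed linear space $X$ is a set of the form $\{A+tu : t\in\mathbb{R},\ t>0\}$ with $A,u\in X$ and $u\neq 0$; $u$ is called its direction. Two half-lines are parallel if their directions are real scalar multiples of each other; a union of parallel half-lines means the union of a family of pairwise parallel half-lines. Unbounded means unbounded in norm. *)

theory Defs
  imports "HOL-Analysis.Analysis"
begin

definition half_line_dir :: "'a::real_normed_vector set \<Rightarrow> 'a \<Rightarrow> bool" where
  "half_line_dir L u \<longleftrightarrow> u \<noteq> 0 \<and> (\<exists>A. L = {A + t *\<^sub>R u | t. t > 0})"

definition half_line :: "'a::real_normed_vector set \<Rightarrow> bool" where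
  "half_line L \<longleftrightarrow> (\<exists>u. half_line_dir L u)"

text \<open>A half-line determines its direction only up to a positive factor, so it does not matter
  which directions are compared. Half-lines pointing in opposite directions are parallel.\<close>

definition parallel_half_lines :: "'a::real_normed_vector set \<Rightarrow> 'a set \<Rightarrow> bool" where
  "parallel_half_lines L M \<longleftrightarrow>
     (\<exists>u v. half_line_dir L u \<and> half_line_dir M v \<and>
        (\<exists>c::real. u = c *\<^sub>R v) \<and> (\<exists>c::real. v = c *\<^sub>R u))"

definition union_of_parallel_half_lines :: "'a::real_normed_vector set \<Rightarrow> bool" where
  "union_of_parallel_half_lines S \<longleftrightarrow>
     (\<exists>F. (\<forall>L\<in>F. half_line L) \<and> pairwise parallel_half_lines F \<and> S = \<Union>F)"

text \<open>A complex normed space is given by a complex scalar multiplication on a real normed space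
  that extends the real one and for which the norm is absolutely homogeneous.\<close>

locale complex_normed_space = vector_space cscale
  for cscale :: "complex \<Rightarrow> 'a::real_normed_vector \<Rightarrow> 'a" +
  assumes cscale_of_real: "cscale (of_real r) x = r *\<^sub>R x"
    and norm_cscale: "norm (cscale c x) = norm c * norm x"

text \<open>The scalar multiplication fixes the scalar field over which the dimension is taken.\<close>

definition finite_dimensional :: "('k::field \<Rightarrow> 'a::ab_group_add \<Rightarrow> 'a) \<Rightarrow> bool" where
  "finite_dimensional scl \<longleftrightarrow> (\<exists>B. finite_dimensional_vector_space scl B)"

end

(*
  If X is finite dimensional, its closed balls are compact, so the normalised terms of an unbounded
  sequence in S accumulate at some u. Openness and convexity give x + t u \<in> S for all x \<in> S, t \<ge> 0,
  and S is the union of these half-lines.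

  If X is infinite dimensional, let W be the span of countably many independent vectors and let f n
  (n \<in> \<nat>) be functionals of norm at most 1 that norm the points of a countable dense subset of W.
  Put K = {y \<in> W. |f n y| \<le> n for all n}. It is unbounded because f 0, ..., f (N - 1) vanish
  simultaneously at some y \<in> W of norm N. The open convex set K + ball 0 1 contains no half-line:
  its direction u would lie in the closure of W and satisfy f n u = 0 for all n, so u = 0.
*)

theory Submission
  imports Defs
begin

section \<open>Dimension and change of scalars\<close>

text \<open>A maximal independent subset of a finite spanning set is a finite basis. Spanning sets
  pass between scalar fields more easily than bases, since independence need not be tracked.\<close>

lemma (in vector_space) finite_dimensional_iff_finite_span:
  "finite_dimensional scale \<longleftrightarrow> (\<exists>A. finite A \<and> span A = UNIV)"
proof
  assume "finite_dimensional scale"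
  then obtain B where "finite_dimensional_vector_space scale B"
    unfolding finite_dimensional_def by blast
  then interpret finite_dimensional_vector_space scale B .
  show "\<exists>A. finite A \<and> span A = UNIV"
    using finite_Basis span_Basis by blast
next
  assume "\<exists>A. finite A \<and> span A = UNIV"
  then obtain A where A: "finite A" "span A = UNIV" by blast
  obtain B where B: "B \<subseteq> A" "independent B" "A \<subseteq> span B"
    using maximal_independent_subset[of A] by blast
  have "span B = UNIV"
    using span_minimal[OF B(3) subspace_span] A(2) by blast
  then have "finite_dimensional_vector_space scale B"
    using A(1) B by unfold_locales (auto intro: finite_subset)
  then show "finite_dimensional scale"
    unfolding finite_dimensional_def by blast
qed

lemma finite_dimensional_scaleR_iff:
  "finite_dimensional (scaleR :: real \<Rightarrow> 'a \<Rightarrow> 'a::real_vector) \<longleftrightarrow>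
    (\<exists>A :: 'a set. finite A \<and> span A = UNIV)"
  by (rule real_vector.finite_dimensional_iff_finite_span)

text \<open>Splitting coefficients into real and imaginary parts shows that \<open>A\<close>
  together with \<open>\<i>\<close> times \<open>A\<close> spans over the reals what
  \<open>A\<close> spans over the complex numbers. Conversely, real combinations are complex
  combinations.\<close>

lemma (in complex_normed_space) finite_dimensional_cscale_iff:
  "finite_dimensional cscale \<longleftrightarrow> finite_dimensional (scaleR :: real \<Rightarrow> 'a \<Rightarrow> 'a)"
proof -
  have "\<exists>B. finite B \<and> Real_Vector_Spaces.span B = (UNIV :: 'a set)" if A: "finite A" "span A = UNIV" for A
  proof -
    let ?B = "A \<union> cscale \<i> ` A"
    have "x \<in> Real_Vector_Spaces.span ?B" if "x \<in> span A" for x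
      using that
    proof (induction rule: span_induct_alt)
      case base
      show ?case by (rule real_vector.span_zero)
    next
      case (step c x y)
      have "cscale c x = cscale (of_real (Re c)) x + cscale (of_real (Im c)) (cscale \<i> x)"
        by (metis complex_eq mult.commute scale_left_distrib scale_scale)
      then have "cscale c x = Re c *\<^sub>R x + Im c *\<^sub>R cscale \<i> x"
        by (simp only: cscale_of_real)
      then show ?case
        using step by (auto intro!: real_vector.span_add real_vector.span_scale intro: real_vector.span_base)
    qed
    then show ?thesis
      using A by (intro exI[of _ ?B]) auto
  qed
  moreover have "\<exists>B. finite B \<and> span B = UNIV"
    if A: "finite A" "Real_Vector_Spaces.span A = (UNIV :: 'a set)" for A
  proof -
    have "x \<in> span A" if "x \<in> Real_Vector_Spaces.span A" for x
      using that
    proof (induction rule: real_vector.span_induct_alt)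
      case base
      show ?case by (rule span_zero)
    next
      case (step c x y)
      then show ?case
        by (metis cscale_of_real span_add span_base span_scale)
    qed
    then show ?thesis
      using A by blast
  qed
  ultimately show ?thesis
    unfolding finite_dimensional_iff_finite_span finite_dimensional_scaleR_iff by blast
qed

section \<open>Recession directions in finite dimension\<close>

text \<open>A limit point of the span is already a limit of points of the span inside one fixed
  ball, and these form a compact, hence closed, set.\<close>

lemma closed_span_if_compact_cball:
  fixes A :: "'a::real_normed_vector set"
  assumes "\<And>r. compact (cball 0 r \<inter> span A)"
  shows "closed (span A)"
proof -
  have "x \<in> span A" if x: "x \<in> closure (span A)" for x
  proof -
    let ?r = "norm x + 1"
    have "x \<in> ball 0 ?r \<inter> closure (span A)"
      using x by simp
    also have "\<dots> \<subseteq> closure (ball 0 ?r \<inter> span A)"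
      by (rule open_Int_closure_subset) simp
    also have "\<dots> \<subseteq> closure (cball 0 ?r \<inter> span A)"
      by (rule closure_mono) auto
    also have "\<dots> = cball 0 ?r \<inter> span A"
      using assms by (intro closure_closed compact_imp_closed)
    finally show ?thesis by simp
  qed
  then show ?thesis
    by (metis closed_closure closure_subset subsetI subset_antisym)
qed

text \<open>Induction on \<open>A\<close>. The hypothesis for all radii makes \<open>span A\<close>
  closed, so a new vector \<open>b\<close> has positive distance from it. This bounds the
  coefficient of \<open>b\<close>, and thereby the remaining part in \<open>span A\<close>, for all
  points of the ball.\<close>

lemma compact_cball_Int_span:
  fixes A :: "'a::real_normed_vector set"
  assumes "finite A"
  shows "compact (cball 0 r \<inter> span A)"
  using assms
proof (induction A arbitrary: r rule: finite_induct)
  case empty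
  have "cball 0 r \<inter> span {} = (if r \<ge> 0 then {0::'a} else {})"
    by auto
  then show ?case by simp
next
  case (insert b A)
  show ?case
  proof (cases "b \<in> span A")
    case True
    then have "span (insert b A) = span A"
      by (rule span_redundant)
    then show ?thesis using insert.IH by simp
  next
    case False
    have "closed (span A)"
      using insert.IH by (rule closed_span_if_compact_cball)
    then have "open (- span A)" by blast
    then obtain e where e: "e > 0" "ball b e \<subseteq> - span A"
      using False open_contains_ball by blast
    define R where "R = r + r / e * norm b"
    \<comment> \<open>A segment in direction \<open>b\<close> plus a ball of \<open>span A\<close>:
      a sum of two compact sets that will contain the ball in question.\<close>
    define K where "K = {x + y | x y. x \<in> (\<lambda>c. c *\<^sub>R b) ` cball 0 (r / e) \<and> y \<in> cball 0 R \<inter> span A}"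
    have "compact ((\<lambda>c. c *\<^sub>R b) ` cball 0 (r / e))"
      by (intro compact_continuous_image continuous_intros) simp
    then have "compact K"
      unfolding K_def using insert.IH by (rule compact_sums)
    have "x \<in> K" if x: "x \<in> cball 0 r" "x \<in> span (insert b A)" for x
    proof -
      obtain c where c: "x - c *\<^sub>R b \<in> span A"
        using x(2) by (auto simp: span_breakdown_eq)
      have "\<bar>c\<bar> * e \<le> norm x"
      proof (cases "c = 0")
        case False
        \<comment> \<open>Dividing by \<open>c\<close> exhibits a point of \<open>span A\<close> at
          distance \<open>norm x / \<bar>c\<bar>\<close> from \<open>b\<close>; this distance is
          therefore at least \<open>e\<close>.\<close>
        have "- ((1 / c) *\<^sub>R (x - c *\<^sub>R b)) \<in> span A"
          using c by (intro span_neg span_scale)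
        also have "- ((1 / c) *\<^sub>R (x - c *\<^sub>R b)) = b - (1 / c) *\<^sub>R x"
          using False by (simp add: scaleR_diff_right)
        finally have "b - (1 / c) *\<^sub>R x \<notin> ball b e"
          using e(2) by blast
        then have "e \<le> norm x / \<bar>c\<bar>"
          by (simp add: dist_norm)
        then show ?thesis
          using False by (simp add: field_simps)
      qed simp
      then have ce: "\<bar>c\<bar> \<le> r / e"
        using x(1) e(1) by (simp add: field_simps)
      have "norm (x - c *\<^sub>R b) \<le> norm x + \<bar>c\<bar> * norm b"
        using norm_triangle_ineq4[of x "c *\<^sub>R b"] by simp
      also have "\<dots> \<le> R"
        unfolding R_def using x(1) ce by (intro add_mono mult_right_mono) auto
      finally have "x - c *\<^sub>R b \<in> cball 0 R \<inter> span A"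
        using c by simp
      moreover have "c *\<^sub>R b \<in> (\<lambda>c. c *\<^sub>R b) ` cball 0 (r / e)"
        using ce by (intro image_eqI[of _ _ c]) auto
      moreover have "x = c *\<^sub>R b + (x - c *\<^sub>R b)" by simp
      ultimately show ?thesis
        unfolding K_def by blast
    qed
    moreover have "K \<subseteq> span (insert b A)"
      unfolding K_def
      by (auto intro!: span_add span_scale simp: span_base) (meson in_mono span_mono subset_insertI)
    ultimately have "cball 0 r \<inter> span (insert b A) = cball 0 r \<inter> K"
      by auto
    then show ?thesis
      using \<open>compact K\<close> by (simp add: closed_Int_compact)
  qed
qed

section \<open>Half-lines inside unbounded open convex sets\<close>

lemma recession_direction:
  fixes S :: "'a::real_normed_vector set"
  assumes fin: "finite_dimensional (scaleR :: real \<Rightarrow> 'a \<Rightarrow> 'a)"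
    and S: "open S" "convex S" "\<not> bounded S"
  obtains u where "u \<noteq> 0" "\<And>x t. x \<in> S \<Longrightarrow> t \<ge> 0 \<Longrightarrow> x + t *\<^sub>R u \<in> S"
proof -
  obtain A :: "'a set" where A: "finite A" "span A = UNIV"
    using fin finite_dimensional_scaleR_iff by blast
  have "\<exists>x\<in>S. norm x > real n" for n
    using S(3) by (meson boundedI not_le)
  then obtain X where X: "\<And>n. X n \<in> S" "\<And>n. norm (X n) > real n"
    by metis
  have X0: "norm (X n) > 0" for n
    using X(2)[of n] by (meson of_nat_0_le_iff order_le_less_trans)
  define U where "U n = (1 / norm (X n)) *\<^sub>R X n" for n
  have U1: "norm (U n) = 1" for n
    using X0[of n] by (simp add: U_def)
  have "compact (cball (0::'a) 1)"
    using compact_cball_Int_span[OF A(1), of 1] A(2) by simp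
  then obtain u r where u: "strict_mono r" "(U \<circ> r) \<longlonglongrightarrow> u"
    unfolding compact_def using U1 by (metis dist_0_norm mem_cball order_refl)
  have "(\<lambda>n. norm ((U \<circ> r) n)) \<longlonglongrightarrow> norm u"
    using u(2) by (rule tendsto_norm)
  then have "norm u = 1"
    by (simp add: U1 LIMSEQ_const_iff)
  have "filterlim (\<lambda>n. norm (X n)) at_top sequentially"
    using X(2) by (intro filterlim_at_top_mono[OF filterlim_real_sequentially] always_eventually)
      (auto intro: less_imp_le)
  then have "filterlim (\<lambda>n. norm (X (r n))) at_top sequentially"
    using filterlim_compose filterlim_subseq[OF u(1)] by blast
  then have inv: "(\<lambda>n. t / norm (X (r n))) \<longlonglongrightarrow> 0" for t :: real
    by (rule real_tendsto_divide_at_top[OF tendsto_const])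
  have "x + t *\<^sub>R u \<in> S" if x: "x \<in> S" and t: "t \<ge> 0" for x t
  proof -
    define s where "s n = t / norm (X (r n))" for n
    \<comment> \<open>Chosen so that the combination of \<open>w n\<close> and
      \<open>X (r n)\<close> with weights \<open>1 - s n\<close> and \<open>s n\<close> is exactly
      \<open>x + t *\<^sub>R u\<close>. Since \<open>w n\<close> tends to \<open>x\<close>, openness
      puts it into \<open>S\<close> eventually.\<close>
    define w where "w n = (1 / (1 - s n)) *\<^sub>R (x + t *\<^sub>R (u - U (r n)))" for n
    have s: "s \<longlonglongrightarrow> 0"
      unfolding s_def by (rule inv)
    have "w \<longlonglongrightarrow> (1 / (1 - 0)) *\<^sub>R (x + t *\<^sub>R (u - u))"
      unfolding w_def using u(2) by (intro tendsto_intros s) (auto simp: o_def)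
    then have "eventually (\<lambda>n. w n \<in> S) sequentially"
      using S(1) x by (simp add: topological_tendstoD)
    moreover have "eventually (\<lambda>n. s n < 1) sequentially"
      using s by (rule order_tendstoD) simp
    ultimately have "eventually (\<lambda>n. w n \<in> S \<and> s n < 1) sequentially"
      by (rule eventually_conj)
    then obtain n where n: "w n \<in> S" "s n < 1"
      using eventually_happens'[OF sequentially_bot] by blast
    have "s n \<ge> 0"
      using t by (simp add: s_def)
    then have "(1 - s n) *\<^sub>R w n + s n *\<^sub>R X (r n) \<in> S"
      using n X(1) S(2) by (intro convexD) auto
    also have "(1 - s n) *\<^sub>R w n = x + t *\<^sub>R (u - U (r n))"
      using n(2) by (simp add: w_def)
    also have "s n *\<^sub>R X (r n) = t *\<^sub>R U (r n)"
      by (simp add: s_def U_def)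
    finally show ?thesis
      by (simp add: scaleR_diff_right)
  qed
  moreover have "u \<noteq> 0"
    using \<open>norm u = 1\<close> by auto
  ultimately show ?thesis
    using that by blast
qed

lemma open_convex_unbounded_union_half_lines:
  fixes S :: "'a::real_normed_vector set"
  assumes "finite_dimensional (scaleR :: real \<Rightarrow> 'a \<Rightarrow> 'a)"
    and S: "open S" "convex S" "\<not> bounded S"
  shows "union_of_parallel_half_lines S"
proof -
  obtain u where u: "u \<noteq> 0" "\<And>x t. x \<in> S \<Longrightarrow> t \<ge> 0 \<Longrightarrow> x + t *\<^sub>R u \<in> S"
    using recession_direction assms by blast
  define ray where "ray x = {x + t *\<^sub>R u | t. t > 0}" for x
  have dir: "half_line_dir (ray x) u" for x
    using u(1) by (auto simp: half_line_dir_def ray_def)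
  have "x \<in> \<Union> (ray ` S)" if x: "x \<in> S" for x
  proof -
    \<comment> \<open>The open half-line \<open>ray x\<close> omits \<open>x\<close> itself, so
      \<open>x\<close> is covered by a half-line starting slightly behind it, still in
      \<open>S\<close>.\<close>
    have "((\<lambda>t. x - t *\<^sub>R u) \<longlongrightarrow> x - 0 *\<^sub>R u) (at_right 0)"
      by (intro tendsto_intros)
    then have "eventually (\<lambda>t. x - t *\<^sub>R u \<in> S) (at_right 0)"
      using S(1) x by (simp add: topological_tendstoD)
    then obtain b where "b > 0" "\<And>t. 0 < t \<Longrightarrow> t < b \<Longrightarrow> x - t *\<^sub>R u \<in> S"
      unfolding eventually_at_right_field by blast
    then have "x - (b / 2) *\<^sub>R u \<in> S" "b / 2 > 0" by auto
    moreover have "x \<in> ray (x - (b / 2) *\<^sub>R u)"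
      unfolding ray_def using \<open>b / 2 > 0\<close> by (auto intro!: exI[of _ "b / 2"])
    ultimately show ?thesis by blast
  qed
  moreover have "ray x \<subseteq> S" if "x \<in> S" for x
    using u(2) that by (auto simp: ray_def)
  ultimately have "S = \<Union> (ray ` S)" by blast
  moreover have "parallel_half_lines (ray x) (ray y)" for x y
    unfolding parallel_half_lines_def using dir by (metis scaleR_one)
  ultimately show ?thesis
    unfolding union_of_parallel_half_lines_def half_line_def pairwise_def
    by (intro exI[of _ "ray ` S"]) (use dir in blast)
qed

section \<open>Norming functionals\<close>

definition sublinear :: "('a::real_vector \<Rightarrow> real) \<Rightarrow> bool" where
  "sublinear p \<longleftrightarrow> (\<forall>x y. p (x + y) \<le> p x + p y) \<and> (\<forall>c\<ge>0. \<forall>x. p (c *\<^sub>R x) = c * p x)"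

text \<open>The inequality for the factor \<open>1 / c\<close> at \<open>c *\<^sub>R x\<close> is
  the reverse of the one for \<open>c\<close> at \<open>x\<close>.\<close>

lemma sublinearI:
  assumes add: "\<And>x y. p (x + y) \<le> p x + p y"
    and zero: "p 0 = 0"
    and scale: "\<And>c x. c > 0 \<Longrightarrow> p (c *\<^sub>R x) \<le> c * p x"
  shows "sublinear p"
proof -
  have "p (c *\<^sub>R x) = c * p x" if "c \<ge> 0" for c x
  proof (cases "c = 0")
    case False
    with that have "c > 0" by simp
    then have "p x \<le> 1 / c * p (c *\<^sub>R x)"
      using scale[of "1 / c" "c *\<^sub>R x"] by simp
    then have "c * p x \<le> p (c *\<^sub>R x)"
      using \<open>c > 0\<close> by (simp add: field_simps)
    then show ?thesis
      using scale[OF \<open>c > 0\<close>, of x] by simp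
  qed (simp add: zero)
  then show ?thesis
    using add by (simp add: sublinear_def)
qed

lemma sublinear_add: "sublinear p \<Longrightarrow> p (x + y) \<le> p x + p y"
  by (simp add: sublinear_def)

lemma sublinear_scale: "sublinear p \<Longrightarrow> c \<ge> 0 \<Longrightarrow> p (c *\<^sub>R x) = c * p x"
  by (simp add: sublinear_def)

lemma sublinear_zero: "sublinear p \<Longrightarrow> p 0 = 0"
  using sublinear_scale[of p 0 0] by simp

lemma sublinear_neg: "sublinear p \<Longrightarrow> - p (- x) \<le> p x"
  using sublinear_add[of p x "- x"] sublinear_zero[of p] by simp

lemma sublinear_norm: "sublinear norm"
  by (rule sublinearI) (auto simp: norm_triangle_ineq)

text \<open>For sublinear \<open>q\<close> this is the largest sublinear functional below
  \<open>q\<close> whose value at \<open>- y\<close> is at most \<open>- q y\<close>; it is thus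
  additive on the pair \<open>y\<close>, \<open>- y\<close>.\<close>

definition sublinear_reduce :: "('a::real_vector \<Rightarrow> real) \<Rightarrow> 'a \<Rightarrow> 'a \<Rightarrow> real" where
  "sublinear_reduce q y x = (INF t\<in>{0..}. q (x + t *\<^sub>R y) - t * q y)"

text \<open>Subadditivity at \<open>x + s *\<^sub>R y\<close> and \<open>- x\<close> bounds the
  family below by \<open>- q (- x)\<close>, so the real infimum really is a lower bound.\<close>

lemma sublinear_reduce_le:
  assumes q: "sublinear q" and "t \<ge> 0"
  shows "sublinear_reduce q y x \<le> q (x + t *\<^sub>R y) - t * q y"
proof -
  have "- q (- x) \<le> q (x + s *\<^sub>R y) - s * q y" if "s \<ge> 0" for s
    using sublinear_add[OF q, of "x + s *\<^sub>R y" "- x"] sublinear_scale[OF q that, of y] by simp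
  then have "bdd_below ((\<lambda>t. q (x + t *\<^sub>R y) - t * q y) ` {0..})"
    by (intro bdd_belowI2[where m = "- q (- x)"]) auto
  then show ?thesis
    unfolding sublinear_reduce_def using assms(2) by (intro cINF_lower) auto
qed

lemma sublinear_reduce_greatest:
  assumes "\<And>t. t \<ge> 0 \<Longrightarrow> m \<le> q (x + t *\<^sub>R y) - t * q y"
  shows "m \<le> sublinear_reduce q y x"
  unfolding sublinear_reduce_def
proof (rule cINF_greatest)
  fix t :: real
  assume "t \<in> {0..}"
  then show "m \<le> q (x + t *\<^sub>R y) - t * q y"
    by (intro assms) simp
qed simp

lemma sublinear_reduce_le_self: "sublinear q \<Longrightarrow> sublinear_reduce q y x \<le> q x"
  using sublinear_reduce_le[of q 0 y x] by simp

text \<open>Parameters \<open>s\<close> for \<open>x\<close> and \<open>t\<close> for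
  \<open>z\<close> combine to \<open>s + t\<close> for \<open>x + z\<close>; the two infima are then
  taken one after the other. Scaling by \<open>c\<close> replaces the parameter \<open>t\<close> by
  \<open>c * t\<close>.\<close>

lemma sublinear_sublinear_reduce:
  assumes q: "sublinear q"
  shows "sublinear (sublinear_reduce q y)"
proof (rule sublinearI)
  fix x z
  have "sublinear_reduce q y (x + z) - (q (z + t *\<^sub>R y) - t * q y) \<le> q (x + s *\<^sub>R y) - s * q y"
    if "s \<ge> 0" "t \<ge> 0" for s t
  proof -
    have "sublinear_reduce q y (x + z) \<le> q ((x + z) + (s + t) *\<^sub>R y) - (s + t) * q y"
      using that by (intro sublinear_reduce_le[OF q]) simp
    also have "(x + z) + (s + t) *\<^sub>R y = (x + s *\<^sub>R y) + (z + t *\<^sub>R y)"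
      by (simp add: algebra_simps)
    finally show ?thesis
      using sublinear_add[OF q, of "x + s *\<^sub>R y" "z + t *\<^sub>R y"] by (simp add: algebra_simps)
  qed
  then have "sublinear_reduce q y (x + z) - (q (z + t *\<^sub>R y) - t * q y) \<le> sublinear_reduce q y x"
    if "t \<ge> 0" for t
    using that by (intro sublinear_reduce_greatest) blast
  then have "sublinear_reduce q y (x + z) - sublinear_reduce q y x \<le> sublinear_reduce q y z"
    by (intro sublinear_reduce_greatest) (smt (verit))
  then show "sublinear_reduce q y (x + z) \<le> sublinear_reduce q y x + sublinear_reduce q y z"
    by simp
next
  have "0 \<le> sublinear_reduce q y 0"
    by (rule sublinear_reduce_greatest) (simp add: sublinear_scale[OF q])
  then show "sublinear_reduce q y 0 = 0"
    using sublinear_reduce_le_self[OF q, of y 0] sublinear_zero[OF q] by simp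
next
  fix c :: real and x
  assume c: "c > 0"
  have "sublinear_reduce q y (c *\<^sub>R x) / c \<le> sublinear_reduce q y x"
  proof (rule sublinear_reduce_greatest)
    fix t :: real
    assume t: "t \<ge> 0"
    have "sublinear_reduce q y (c *\<^sub>R x) \<le> q (c *\<^sub>R x + (c * t) *\<^sub>R y) - (c * t) * q y"
      using c t by (intro sublinear_reduce_le[OF q]) simp
    also have "c *\<^sub>R x + (c * t) *\<^sub>R y = c *\<^sub>R (x + t *\<^sub>R y)"
      by (simp add: algebra_simps)
    also have "q (c *\<^sub>R (x + t *\<^sub>R y)) = c * q (x + t *\<^sub>R y)"
      using c by (simp add: sublinear_scale[OF q])
    finally show "sublinear_reduce q y (c *\<^sub>R x) / c \<le> q (x + t *\<^sub>R y) - t * q y"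
      using c by (simp add: field_simps)
  qed
  then show "sublinear_reduce q y (c *\<^sub>R x) \<le> c * sublinear_reduce q y x"
    using c by (simp add: field_simps)
qed

text \<open>Supplies the bounds of chains for Zorn's lemma. Of two members of the chain one lies
  below both, which gives subadditivity of the infimum; the common bound \<open>p\<close> keeps the
  values above \<open>- p (- x)\<close>.\<close>

lemma sublinear_INF_chain:
  fixes C :: "('a::real_vector \<Rightarrow> real) set"
  assumes sub: "\<And>q. q \<in> C \<Longrightarrow> sublinear q" and "C \<noteq> {}"
    and bound: "\<And>q x. q \<in> C \<Longrightarrow> q x \<le> p x"
    and chain: "\<And>q r. q \<in> C \<Longrightarrow> r \<in> C \<Longrightarrow> q \<le> r \<or> r \<le> q"
  shows "sublinear (\<lambda>x. INF q\<in>C. q x)" and "\<And>q x. q \<in> C \<Longrightarrow> (INF q\<in>C. q x) \<le> q x"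
proof -
  have bdd: "bdd_below ((\<lambda>q. q x) ` C)" for x
  proof (rule bdd_belowI2)
    fix q assume "q \<in> C"
    then show "- p (- x) \<le> q x"
      using sublinear_neg[OF sub, of q x] bound[of q "- x"] by simp
  qed
  show lower: "(INF q\<in>C. q x) \<le> q x" if "q \<in> C" for q x
    using that bdd by (intro cINF_lower)
  show "sublinear (\<lambda>x. INF q\<in>C. q x)"
  proof (rule sublinearI)
    fix x y
    have "(INF q\<in>C. q (x + y)) \<le> q x + r y" if qr: "q \<in> C" "r \<in> C" for q r
    proof -
      obtain s where s: "s \<in> C" "s \<le> q" "s \<le> r"
        using chain[OF qr] qr by blast
      have "(INF q\<in>C. q (x + y)) \<le> s (x + y)"
        using s(1) by (rule lower)
      also have "\<dots> \<le> s x + s y"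
        using sublinear_add[OF sub[OF s(1)]] .
      also have "\<dots> \<le> q x + r y"
        using s by (auto simp: le_fun_def intro: add_mono)
      finally show ?thesis .
    qed
    then have "(INF q\<in>C. q (x + y)) - r y \<le> (INF q\<in>C. q x)" if "r \<in> C" for r
      using that \<open>C \<noteq> {}\<close> by (intro cINF_greatest) (auto simp: algebra_simps)
    then have "(INF q\<in>C. q (x + y)) - (INF q\<in>C. q x) \<le> (INF q\<in>C. q y)"
      using \<open>C \<noteq> {}\<close> by (intro cINF_greatest) (auto simp: algebra_simps)
    then show "(INF q\<in>C. q (x + y)) \<le> (INF q\<in>C. q x) + (INF q\<in>C. q y)"
      by simp
  next
    show "(INF q\<in>C. q 0) = 0"
      using \<open>C \<noteq> {}\<close> sub by (simp add: sublinear_zero)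
  next
    fix c :: real and x
    assume c: "c > 0"
    have "(INF q\<in>C. q (c *\<^sub>R x)) / c \<le> (INF q\<in>C. q x)"
    proof (rule cINF_greatest[OF \<open>C \<noteq> {}\<close>])
      fix q assume q: "q \<in> C"
      have "(INF q\<in>C. q (c *\<^sub>R x)) \<le> c * q x"
        using lower[OF q, of "c *\<^sub>R x"] sublinear_scale[OF sub[OF q], of c x] c by simp
      then show "(INF q\<in>C. q (c *\<^sub>R x)) / c \<le> q x"
        using c by (simp add: field_simps)
    qed
    then show "(INF q\<in>C. q (c *\<^sub>R x)) \<le> c * (INF q\<in>C. q x)"
      using c by (simp add: field_simps)
  qed
qed

text \<open>A minimal sublinear functional is linear because reducing it in any direction leaves it unchanged;
  this gives the Hahn-Banach theorem without extending functionals one dimension at a time.\<close>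

lemma minimal_sublinear_exists:
  assumes p: "sublinear p"
  obtains m where "sublinear m" "m \<le> p" "\<And>q. sublinear q \<Longrightarrow> q \<le> m \<Longrightarrow> q = m"
proof -
  let ?A = "{q. sublinear q \<and> q \<le> p}"
  \<comment> \<open>The reversed pointwise order: maximal elements are minimal functionals, and
    infima bound chains.\<close>
  let ?P = "\<lambda>a b :: 'a \<Rightarrow> real. b \<le> a"
  have "\<exists>m\<in>?A. \<forall>a\<in>?A. ?P m a \<longrightarrow> a = m"
  proof (rule predicate_Zorn)
    show "partial_order_on ?A (relation_of ?P ?A)"
      by (rule partial_order_on_relation_ofI) auto
  next
    fix C assume C: "C \<in> Chains (relation_of ?P ?A)"
    have CA: "C \<subseteq> ?A"
      using C by (rule Chains_relation_of)
    show "\<exists>u\<in>?A. \<forall>a\<in>C. ?P a u"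
    proof (cases "C = {}")
      case True
      then show ?thesis using p by auto
    next
      case False
      let ?u = "\<lambda>x. INF q\<in>C. q x"
      have bound: "q x \<le> p x" if "q \<in> C" for q x
        using that CA by (auto simp: le_fun_def)
      have sub: "sublinear q" if "q \<in> C" for q
        using that CA by auto
      have chain: "q \<le> r \<or> r \<le> q" if "q \<in> C" "r \<in> C" for q r
        using C that unfolding Chains_def relation_of_def by blast
      have u: "sublinear ?u"
        using sub False bound chain by (rule sublinear_INF_chain(1))
      have lower: "?u x \<le> a x" if "a \<in> C" for a x
        using sub False bound chain that by (rule sublinear_INF_chain(2))
      have "?u \<le> a" if "a \<in> C" for a
        using lower that by (simp add: le_fun_def)
      moreover from this have "?u \<le> p"
        using False CA by (meson bound ex_in_conv le_funI order_trans)
      ultimately show ?thesis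
        using u by blast
    qed
  qed
  \<comment> \<open>Whatever lies below \<open>m\<close> lies below \<open>p\<close>, so minimality
    within \<open>?A\<close> is minimality among all sublinear functionals.\<close>
  then show ?thesis
    using that by (metis (no_types, lifting) mem_Collect_eq order_trans)
qed

lemma minimal_sublinear_linear:
  assumes m: "sublinear m" and min: "\<And>q. sublinear q \<Longrightarrow> q \<le> m \<Longrightarrow> q = m"
  shows "linear m"
proof -
  have red: "sublinear_reduce m y = m" for y
    using sublinear_sublinear_reduce[OF m] sublinear_reduce_le_self[OF m]
    by (intro min) (auto simp: le_fun_def)
  \<comment> \<open>By \<open>red\<close>, the bound at parameter 1 reads
    \<open>m x \<le> m (x + y) - m y\<close>, the reverse of subadditivity.\<close>
  have add: "m (x + y) = m x + m y" for x y
    using sublinear_reduce_le[OF m, of 1 y x] sublinear_add[OF m, of x y] by (simp add: red)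
  have neg: "m (- x) = - m x" for x
    using add[of x "- x"] sublinear_zero[OF m] by simp
  have "m (c *\<^sub>R x) = c * m x" for c x
  proof (cases "c \<ge> 0")
    case False
    then have "m (- c *\<^sub>R x) = - c * m x"
      using sublinear_scale[OF m, of "- c" x] by simp
    then show ?thesis using neg[of "c *\<^sub>R x"] by simp
  qed (simp add: sublinear_scale[OF m])
  then show ?thesis
    using add by (intro linearI) auto
qed

text \<open>Starting from the reduction of the norm in the direction \<open>y\<close> forces \<open>f (- y) \<le> - norm y\<close>.\<close>

lemma norming_functional_exists:
  fixes y :: "'a::real_normed_vector"
  obtains f :: "'a \<Rightarrow> real" where "linear f" "\<And>x. \<bar>f x\<bar> \<le> norm x" "f y = norm y"
proof -
  obtain f where f: "sublinear f" "f \<le> sublinear_reduce norm y" "\<And>q. sublinear q \<Longrightarrow> q \<le> f \<Longrightarrow> q = f"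
    using minimal_sublinear_exists[OF sublinear_sublinear_reduce[OF sublinear_norm]] by metis
  have lin: "linear f"
    using f(1,3) by (rule minimal_sublinear_linear)
  have le: "f x \<le> norm x" for x
    using f(2) sublinear_reduce_le_self[OF sublinear_norm] by (meson le_funD order_trans)
  have "\<bar>f x\<bar> \<le> norm x" for x
    using le[of x] le[of "- x"] linear_neg[OF lin, of x] by simp
  moreover have "f (- y) \<le> - norm y"
    using le_funD[OF f(2), of "- y"] sublinear_reduce_le[OF sublinear_norm, of 1 y "- y"] by simp
  then have "f y = norm y"
    using le[of y] linear_neg[OF lin, of y] by simp
  ultimately show ?thesis
    using that lin by blast
qed

section \<open>A convex set without half-lines in infinite dimension\<close>

text \<open>\<open>D\<close> consists of the rational combinations of \<open>E\<close>, coded by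
  lists so that countability is immediate and adding a term is prepending an entry. Density follows
  by adding one term at a time.\<close>

lemma countable_dense_in_span:
  fixes E :: "'a::real_normed_vector set"
  assumes "countable E"
  obtains D where "countable D" "D \<subseteq> span E" "span E \<subseteq> closure D"
proof -
  define g :: "(rat \<times> 'a) list \<Rightarrow> 'a" where "g l = (\<Sum>(r, x)\<leftarrow>l. of_rat r *\<^sub>R x)" for l
  define D where "D = g ` lists (UNIV \<times> E)"
  have cnt: "countable D"
    unfolding D_def using assms by (intro countable_image countable_lists countable_SIGMA) auto
  have "g l \<in> span E" if "l \<in> lists (UNIV \<times> E)" for l
    using that unfolding g_def
    by (induction l) (auto intro!: span_zero span_add span_scale intro: span_base)
  then have sub: "D \<subseteq> span E"
    by (auto simp: D_def)
  have D0: "0 \<in> D"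
    unfolding D_def by (rule image_eqI[of _ _ "[]"]) (auto simp: g_def)
  have Dadd: "of_rat r *\<^sub>R x + y \<in> D" if x: "x \<in> E" and y: "y \<in> D" for r x y
  proof -
    obtain l where "l \<in> lists (UNIV \<times> E)" "y = g l"
      using y by (auto simp: D_def)
    then have "(r, x) # l \<in> lists (UNIV \<times> E)" "of_rat r *\<^sub>R x + y = g ((r, x) # l)"
      using x by (auto simp: g_def)
    then show ?thesis
      unfolding D_def by blast
  qed
  have "x \<in> closure D" if "x \<in> span E" for x
    using that
  proof (induction rule: span_induct_alt)
    case base
    show ?case using D0 closure_subset by blast
  next
    case (step c x y)
    show ?case
    proof (unfold closure_approachable, intro allI impI)
      fix e :: real assume e: "e > 0"
      \<comment> \<open>The summand 1 keeps the denominator positive when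
        \<open>x = 0\<close>.\<close>
      define d where "d = e / (2 * (norm x + 1))"
      have nx: "norm x + 1 > 0"
        using norm_ge_zero[of x] by linarith
      have "d > 0"
        using e nx by (simp add: d_def)
      then obtain r where r: "c < of_rat r" "of_rat r < c + d"
        using of_rat_dense[of c "c + d"] by auto
      obtain z where z: "z \<in> D" "dist z y < e / 2"
        using step.IH e unfolding closure_approachable by (meson half_gt_zero)
      have "dist (of_rat r *\<^sub>R x + z) (c *\<^sub>R x + y) = norm ((of_rat r - c) *\<^sub>R x + (z - y))"
        by (simp add: dist_norm algebra_simps)
      also have "\<dots> \<le> \<bar>of_rat r - c\<bar> * norm x + norm (z - y)"
        by (metis norm_scaleR norm_triangle_ineq)
      also have "\<bar>of_rat r - c\<bar> * norm x \<le> d * (norm x + 1)"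
        using r by (intro mult_mono) auto
      also have "d * (norm x + 1) = e / 2"
        using nx by (simp add: d_def field_simps)
      finally have "dist (of_rat r *\<^sub>R x + z) (c *\<^sub>R x + y) < e"
        using z(2) by (simp add: dist_norm)
      then show "\<exists>z\<in>D. dist z (c *\<^sub>R x + y) < e"
        using Dadd[OF step.hyps z(1)] by blast
    qed
  qed
  then show ?thesis
    using that cnt sub by blast
qed

section \<open>Common kernels of finitely many functionals\<close>

text \<open>A kernel has codimension at most one: if \<open>f w\<close> is nonzero, subtracting a
  multiple of \<open>w\<close> moves any point of \<open>W\<close> into the kernel.\<close>

lemma finite_span_if_kernel_finite_span:
  assumes W: "subspace W" and f: "linear (f :: 'a::real_vector \<Rightarrow> real)"
    and A: "finite A" "{x \<in> W. f x = 0} \<subseteq> span A"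
  shows "\<exists>B. finite B \<and> W \<subseteq> span B"
proof (cases "\<exists>w\<in>W. f w \<noteq> 0")
  case True
  then obtain w where w: "w \<in> W" "f w \<noteq> 0" by blast
  have "x \<in> span (insert w A)" if x: "x \<in> W" for x
  proof -
    let ?z = "x - (f x / f w) *\<^sub>R w"
    have "?z \<in> W"
      using W x w by (intro subspace_diff subspace_scale)
    moreover have "f ?z = 0"
      using w f by (simp add: linear_diff linear_scale)
    ultimately show ?thesis
      using A(2) by (auto simp: span_breakdown_eq)
  qed
  then show ?thesis
    using A(1) by (intro exI[of _ "insert w A"]) auto
qed (use A in blast)

text \<open>Each further kernel loses at most one dimension, so infinite dimension survives every
  step.\<close>

lemma common_kernel_infinite:
  assumes W: "subspace W" "\<nexists>A. finite A \<and> W \<subseteq> span A"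
    and f: "\<And>n::nat. linear (f n :: 'a::real_vector \<Rightarrow> real)"
  shows "subspace {x \<in> W. \<forall>n<N. f n x = 0} \<and> (\<nexists>A. finite A \<and> {x \<in> W. \<forall>n<N. f n x = 0} \<subseteq> span A)"
proof (induction N)
  case 0
  then show ?case using W by simp
next
  case (Suc N)
  let ?V = "{x \<in> W. \<forall>n<N. f n x = 0}"
  have eq: "{x \<in> W. \<forall>n<Suc N. f n x = 0} = {x \<in> ?V. f N x = 0}"
    by (auto simp: less_Suc_eq)
  have "subspace {x \<in> ?V. f N x = 0}"
    using Suc f[of N] by (auto simp: subspace_def linear_add linear_scale linear_0)
  moreover have "\<nexists>A. finite A \<and> {x \<in> ?V. f N x = 0} \<subseteq> span A"
    using Suc finite_span_if_kernel_finite_span[of ?V "f N"] f[of N] by blast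
  ultimately show ?case
    unfolding eq by blast
qed

text \<open>Turns bounds that are uniform along a half-line into the vanishing of
  \<open>f n u\<close> and of \<open>norm u\<close>.\<close>

lemma eq_0_if_multiples_bounded:
  fixes a b :: real
  assumes "\<And>t. t > 0 \<Longrightarrow> t * a \<le> b" "a \<ge> 0"
  shows "a = 0"
proof (rule ccontr)
  assume "a \<noteq> 0"
  then have "a > 0" using assms(2) by simp
  then have "(\<bar>b\<bar> + 1) / a * a \<le> b"
    by (intro assms(1)) simp
  then show False
    using \<open>a > 0\<close> by simp
qed

section \<open>Construction of the counterexample\<close>

lemma infinite_dimensional_convex_without_half_line:
  assumes inf: "\<not> finite_dimensional (scaleR :: real \<Rightarrow> 'a \<Rightarrow> 'a::real_normed_vector)"
  obtains S :: "'a::real_normed_vector set" where "open S" "convex S" "\<not> bounded S" "\<And>L. half_line L \<Longrightarrow> \<not> L \<subseteq> S"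
proof -
  obtain B :: "'a set" where B: "independent B" "UNIV \<subseteq> span B"
    using maximal_independent_subset[of "UNIV :: 'a set"] by metis
  then have "infinite B"
    using inf finite_dimensional_scaleR_iff by blast
  then obtain e :: "nat \<Rightarrow> 'a" where e: "inj e" "range e \<subseteq> B"
    using infinite_countable_subset by blast
  \<comment> \<open>The whole space may fail to be separable; the span of countably many vectors is
    separable, so a sequence of norming functionals suffices.\<close>
  define W where "W = span (range e)"
  have W: "subspace W"
    by (simp add: W_def)
  have "\<not> W \<subseteq> span A" if "finite A" for A
  proof
    assume "W \<subseteq> span A"
    then have "range e \<subseteq> span A"
      unfolding W_def using span_superset by blast
    moreover have "independent (range e)"
      using B(1) e(2) by (rule independent_mono)
    ultimately have "finite (range e)"
      using independent_span_bound[OF that] by blast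
    then show False
      using e(1) by (simp add: finite_image_iff)
  qed
  then have Winf: "\<nexists>A. finite A \<and> W \<subseteq> span A" by blast
  obtain D where D: "countable D" "D \<subseteq> W" "W \<subseteq> closure D"
    unfolding W_def using countable_dense_in_span[of "range e"] by auto
  have "D \<noteq> {}"
    using D(3) subspace_0[OF W] by auto
  define d where "d = from_nat_into D"
  have d: "range d = D"
    unfolding d_def using D(1) \<open>D \<noteq> {}\<close> by (rule range_from_nat_into[rotated])
  have "\<exists>f :: 'a \<Rightarrow> real. linear f \<and> (\<forall>x. \<bar>f x\<bar> \<le> norm x) \<and> f (d n) = norm (d n)" for n
    using norming_functional_exists[of "d n"] by metis
  then obtain f :: "nat \<Rightarrow> 'a \<Rightarrow> real" where f: "\<And>n. linear (f n)" "\<And>n x. \<bar>f n x\<bar> \<le> norm x"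
      "\<And>n. f n (d n) = norm (d n)"
    by metis
  \<comment> \<open>Each single \<open>f n\<close> is bounded on \<open>K\<close>, which excludes
    half-lines, while the bounds grow with \<open>n\<close>, which leaves room for points of large
    norm.\<close>
  define K where "K = {y \<in> W. \<forall>n. \<bar>f n y\<bar> \<le> real n}"
  define S where "S = (\<Union>y\<in>K. \<Union>b\<in>ball 0 1. {y + b})"
  have S_iff: "x \<in> S \<longleftrightarrow> (\<exists>y\<in>K. norm (x - y) < 1)" for x
  proof
    assume "\<exists>y\<in>K. norm (x - y) < 1"
    then obtain y where "y \<in> K" "norm (x - y) < 1" by blast
    then show "x \<in> S"
      unfolding S_def by (intro UN_I[of y] UN_I[of "x - y"]) auto
  next
    assume "x \<in> S"
    then obtain y b where "y \<in> K" "norm b < 1" "x = y + b"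
      by (auto simp: S_def)
    then show "\<exists>y\<in>K. norm (x - y) < 1"
      by (intro bexI[of _ y]) auto
  qed
  have "S = (\<Union>y\<in>K. ball y 1)"
    by (auto simp: S_iff dist_norm norm_minus_commute)
  then have "open S" by auto
  have "convex K"
  proof (rule convexI)
    fix x y and u v :: real
    assume xy: "x \<in> K" "y \<in> K" and uv: "0 \<le> u" "0 \<le> v" "u + v = 1"
    have "\<bar>f n (u *\<^sub>R x + v *\<^sub>R y)\<bar> \<le> real n" for n
    proof -
      have "\<bar>f n (u *\<^sub>R x + v *\<^sub>R y)\<bar> \<le> u * \<bar>f n x\<bar> + v * \<bar>f n y\<bar>"
        using f(1)[of n] uv abs_triangle_ineq[of "u * f n x" "v * f n y"]
        by (simp add: linear_add linear_scale abs_mult)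
      also have "\<dots> \<le> real n"
        using xy uv by (intro convex_bound_le) (auto simp: K_def)
      finally show ?thesis .
    qed
    then show "u *\<^sub>R x + v *\<^sub>R y \<in> K"
      using xy W by (auto simp: K_def subspace_add subspace_scale)
  qed
  then have "convex S"
    unfolding S_def by (intro convex_sums) auto
  have "\<exists>x\<in>S. norm x \<ge> real N" for N
  proof -
    let ?V = "{x \<in> W. \<forall>n<N. f n x = 0}"
    note ker = common_kernel_infinite[OF W Winf f(1), of N]
    have V: "subspace ?V"
      using ker by (rule conjunct1)
    \<comment> \<open>Infinite dimension is used here to obtain a nonzero vector killed by the first
      \<open>N\<close> functionals.\<close>
    have "\<not> ?V \<subseteq> span {}"
    proof
      assume "?V \<subseteq> span {}"
      then have "\<exists>A. finite A \<and> ?V \<subseteq> span A"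
        by (intro exI[of _ "{}"] conjI finite.emptyI)
      with conjunct2[OF ker] show False
        by (rule notE)
    qed
    then obtain v where v: "v \<in> ?V" "v \<notin> span {}"
      unfolding subset_iff by blast
    have "v \<noteq> 0"
      using v(2) span_zero by metis
    define y where "y = (real N / norm v) *\<^sub>R v"
    have "y \<in> ?V"
      unfolding y_def using V v(1) by (rule subspace_scale)
    moreover have "norm y = real N"
      using \<open>v \<noteq> 0\<close> by (simp add: y_def)
    \<comment> \<open>For \<open>n < N\<close> the value is 0; otherwise it is at most
      \<open>norm y = real N \<le> real n\<close>.\<close>
    moreover have "\<bar>f n y\<bar> \<le> real n" for n
      using f(2)[of n y] calculation by (cases "n < N") auto
    ultimately have "y \<in> K"
      by (simp add: K_def)
    then have "y \<in> S"
      unfolding S_iff by (intro bexI[of _ y]) auto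
    then show ?thesis
      using \<open>norm y = real N\<close> by (intro bexI[of _ y]) simp_all
  qed
  then have unbounded: "\<exists>x\<in>S. real N \<le> norm x" for N .
  have "\<not> bounded S"
  proof
    assume "bounded S"
    then obtain C where C: "\<And>x. x \<in> S \<Longrightarrow> norm x \<le> C"
      unfolding bounded_iff by blast
    obtain N where "C < real N"
      using reals_Archimedean2 by blast
    then show False
      using unbounded[of N] C by fastforce
  qed
  have "\<not> L \<subseteq> S" if L: "half_line L" for L
  proof
    assume "L \<subseteq> S"
    obtain u a where u: "u \<noteq> 0" "L = {a + t *\<^sub>R u | t. t > 0}"
      using L unfolding half_line_def half_line_dir_def by blast
    have "\<exists>y\<in>K. norm (a + t *\<^sub>R u - y) < 1" if "t > 0" for t
    proof -
      have "a + t *\<^sub>R u \<in> L"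
        using that u(2) by blast
      then show ?thesis
        using \<open>L \<subseteq> S\<close> unfolding S_iff[symmetric] by blast
    qed
    then obtain y where y: "\<And>t. t > 0 \<Longrightarrow> y t \<in> K" "\<And>t. t > 0 \<Longrightarrow> norm (a + t *\<^sub>R u - y t) < 1"
      by metis
    have near: "norm (t *\<^sub>R u - y t) \<le> norm a + 1" if "t > 0" for t
      using y(2)[OF that] norm_triangle_ineq4[of "a + t *\<^sub>R u - y t" a] by (simp add: algebra_simps)
    have fu: "f n u = 0" for n
    proof -
      \<comment> \<open>\<open>f n\<close> is bounded on \<open>K\<close>, and
        \<open>t *\<^sub>R u\<close> stays within a fixed distance of \<open>K\<close>.\<close>
      have "t * \<bar>f n u\<bar> \<le> real n + (norm a + 1)" if "t > 0" for t
      proof -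
        have "t * \<bar>f n u\<bar> = \<bar>f n (y t) + f n (t *\<^sub>R u - y t)\<bar>"
          using that f(1)[of n] by (simp add: linear_diff linear_scale abs_mult)
        also have "\<dots> \<le> \<bar>f n (y t)\<bar> + \<bar>f n (t *\<^sub>R u - y t)\<bar>"
          by (rule abs_triangle_ineq)
        also have "\<dots> \<le> real n + (norm a + 1)"
          using y(1)[OF that] f(2)[of n "t *\<^sub>R u - y t"] near[OF that]
          by (intro add_mono) (auto simp: K_def)
        finally show ?thesis .
      qed
      then have "\<bar>f n u\<bar> = 0"
        by (rule eq_0_if_multiples_bounded) simp_all
      then show ?thesis by simp
    qed
    \<comment> \<open>A point \<open>d n\<close> near \<open>y t\<close> stays within
      \<open>norm a + 2\<close> of \<open>t *\<^sub>R u\<close>. As \<open>f n\<close> norms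
      \<open>d n\<close> and kills \<open>u\<close>, the norm of \<open>d n\<close> is bounded
      independently of \<open>t\<close>, and so is that of \<open>t *\<^sub>R u\<close>.\<close>
    have "t * norm u \<le> 2 * (norm a + 2)" if t: "t > 0" for t
    proof -
      have "y t \<in> closure D"
        using y(1)[OF t] D(3) unfolding K_def by blast
      then obtain z where z: "z \<in> D" "dist z (y t) < 1"
        unfolding closure_approachable using zero_less_one by blast
      then obtain n where n: "dist (d n) (y t) < 1"
        using d by blast
      have *: "norm (d n - t *\<^sub>R u) \<le> norm a + 2"
        using n near[OF t] norm_triangle_ineq4[of "d n - y t" "t *\<^sub>R u - y t"]
        by (simp add: dist_norm)
      have "norm (d n) = \<bar>f n (d n - t *\<^sub>R u)\<bar>"
        using f(1)[of n] f(3)[of n] fu[of n] by (simp add: linear_diff linear_scale)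
      also have "\<dots> \<le> norm a + 2"
        using f(2) * by (rule order_trans)
      finally show ?thesis
        using * t norm_triangle_ineq4[of "d n" "d n - t *\<^sub>R u"] by simp
    qed
    then have "norm u = 0"
      by (rule eq_0_if_multiples_bounded) simp_all
    then show False
      using u(1) by simp
  qed
  then show ?thesis
    using that \<open>open S\<close> \<open>convex S\<close> \<open>\<not> bounded S\<close> by blast
qed

section \<open>The equivalence over both scalar fields\<close>

text \<open>The right-hand side involves only the real structure of the space, so the complex case
  reduces to this one by comparing the two notions of dimension.\<close>

lemma finite_dimensional_scaleR_iff_half_lines:
  "finite_dimensional (scaleR :: real \<Rightarrow> 'a \<Rightarrow> 'a::real_normed_vector) \<longleftrightarrow>
    (\<forall>S :: 'a set. open S \<and> convex S \<and> \<not> bounded S \<longrightarrow> union_of_parallel_half_lines S)"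
proof
  assume R: "\<forall>S :: 'a set. open S \<and> convex S \<and> \<not> bounded S \<longrightarrow> union_of_parallel_half_lines S"
  show "finite_dimensional (scaleR :: real \<Rightarrow> 'a \<Rightarrow> 'a)"
  proof (rule ccontr)
    assume "\<not> finite_dimensional (scaleR :: real \<Rightarrow> 'a \<Rightarrow> 'a)"
    then obtain S :: "'a set" where S: "open S" "convex S" "\<not> bounded S" "\<And>L. half_line L \<Longrightarrow> \<not> L \<subseteq> S"
      using infinite_dimensional_convex_without_half_line by blast
    then obtain F where F: "\<forall>L\<in>F. half_line L" "S = \<Union>F"
      using R unfolding union_of_parallel_half_lines_def by blast
    \<comment> \<open>This forces \<open>F\<close> to have a member, which is a half-line inside
      \<open>S\<close>.\<close>
    have "S \<noteq> {}"
      using S(3) by auto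
    then show False
      using F S(4) by blast
  qed
qed (use open_convex_unbounded_union_half_lines in blast)

theorem theorem4p3:
  shows "(finite_dimensional (scaleR :: real \<Rightarrow> 'a \<Rightarrow> 'a::real_normed_vector) \<longleftrightarrow>
            (\<forall>S :: 'a set. open S \<and> convex S \<and> \<not> bounded S \<longrightarrow> union_of_parallel_half_lines S))
       \<and> (\<forall>cscale :: complex \<Rightarrow> 'b \<Rightarrow> 'b::real_normed_vector. complex_normed_space cscale \<longrightarrow>
            (finite_dimensional cscale \<longleftrightarrow>
            (\<forall>S :: 'b set. open S \<and> convex S \<and> \<not> bounded S \<longrightarrow> union_of_parallel_half_lines S)))"
proof (intro conjI allI impI)
  show "finite_dimensional (scaleR :: real \<Rightarrow> 'a \<Rightarrow> 'a) \<longleftrightarrow>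
      (\<forall>S :: 'a set. open S \<and> convex S \<and> \<not> bounded S \<longrightarrow> union_of_parallel_half_lines S)"
    by (rule finite_dimensional_scaleR_iff_half_lines)
next
  fix cscale :: "complex \<Rightarrow> 'b \<Rightarrow> 'b"
  assume "complex_normed_space cscale"
  then have "finite_dimensional cscale \<longleftrightarrow> finite_dimensional (scaleR :: real \<Rightarrow> 'b \<Rightarrow> 'b)"
    by (rule complex_normed_space.finite_dimensional_cscale_iff)
  then show "finite_dimensional cscale \<longleftrightarrow>
      (\<forall>S :: 'b set. open S \<and> convex S \<and> \<not> bounded S \<longrightarrow> union_of_parallel_half_lines S)"
    unfolding finite_dimensional_scaleR_iff_half_lines .
qed

end
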